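(* Let $R$ be a commutative ring with identity that is not an integral domain, and suppose that the nil-graph of ideals $\mathbb{AG}_N(R)$ is bipartite. Then $\mathbb{AG}_N(R)$ is complete bipartite. Moreover, if $R$ is non-reduced, then $\mathbb{AG}_N(R)$ is a star graph and ${\rm Nil}(R)$ is the unique minimal prime ideal of $R$.
   Context: All rings are commutative with identity $1\neq 0$. ${\rm Nil}(R)$ is the nilradical of $R$; $R$ is reduced if ${\rm Nil}(R)=(0)$. An ideal is non-trivial if it is nonzero and proper. The nil-graph of ideals $\mathbb{AG}_N(R)$ is the simple graph whose vertices are the nonzero proper ideals $I$ of $R$ for which there exists a non-trivial ideal $J$ of $R$ with $IJ\subseteq {\rm Nil}(R)$; two distinct vertices $I,J$ are adjacent if and only if $IJ\subseteq {\rm Nil}(R)$. A bipartite graph is a graph whose vertices can be divided into two disjoint parts $U,V$ such that every edge joins a vertex of $U$ to a vertex of $V$; it is complete bipartite if (for such a partition) every vertex of one part is joined to every vertex of the other part. A star graph is a complete bipartite graph in which one of the parts has size $1$. A part may be empty, so the one-vertex graph $K_1$ counts as bipartite, complete bipartite and a star. *)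

theory Defs
  imports "HOL-Algebra.Algebra" "Graph_Theory.Pair_Digraph"
begin

section \<open>Rings\<close>

definition nilradical :: "('a, 'b) ring_scheme \<Rightarrow> 'a set" where
  "nilradical R = {x \<in> carrier R. \<exists>n::nat. x [^]\<^bsub>R\<^esub> n = \<zero>\<^bsub>R\<^esub>}"

definition reduced_ring :: "('a, 'b) ring_scheme \<Rightarrow> bool" where
  "reduced_ring R \<longleftrightarrow> nilradical R = {\<zero>\<^bsub>R\<^esub>}"

definition nontrivial_ideal :: "'a set \<Rightarrow> ('a, 'b) ring_scheme \<Rightarrow> bool" where
  "nontrivial_ideal I R \<longleftrightarrow> ideal I R \<and> I \<noteq> {\<zero>\<^bsub>R\<^esub>} \<and> I \<noteq> carrier R"

definition minimal_primeideal :: "'a set \<Rightarrow> ('a, 'b) ring_scheme \<Rightarrow> bool" where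
  "minimal_primeideal P R \<longleftrightarrow> primeideal P R \<and> (\<forall>Q. primeideal Q R \<longrightarrow> Q \<subseteq> P \<longrightarrow> Q = P)"


section \<open>Bipartite graphs\<close>

text \<open>
  A simple graph, possibly infinite, is represented as a loop-free symmetric digraph
  (\<^locale>\<open>pair_bidirected_digraph\<close>), so that an edge contributes both of its orientations.
  The parts of a bipartition may be empty.
\<close>

definition bipartition :: "'a pair_pre_digraph \<Rightarrow> 'a set \<Rightarrow> 'a set \<Rightarrow> bool" where
  "bipartition G U V \<longleftrightarrow>
     pverts G = U \<union> V \<and> U \<inter> V = {} \<and> parcs G \<subseteq> U \<times> V \<union> V \<times> U"

definition complete_bipartition :: "'a pair_pre_digraph \<Rightarrow> 'a set \<Rightarrow> 'a set \<Rightarrow> bool" where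
  "complete_bipartition G U V \<longleftrightarrow>
     bipartition G U V \<and> (\<forall>u\<in>U. \<forall>v\<in>V. (u, v) \<in> parcs G \<and> (v, u) \<in> parcs G)"

definition bipartite :: "'a pair_pre_digraph \<Rightarrow> bool" where
  "bipartite G \<longleftrightarrow> (\<exists>U V. bipartition G U V)"

definition complete_bipartite :: "'a pair_pre_digraph \<Rightarrow> bool" where
  "complete_bipartite G \<longleftrightarrow> (\<exists>U V. complete_bipartition G U V)"

definition star_graph :: "'a pair_pre_digraph \<Rightarrow> bool" where
  "star_graph G \<longleftrightarrow> (\<exists>U V. complete_bipartition G U V \<and> (card U = 1 \<or> card V = 1))"


section \<open>The nil-graph of ideals\<close>

text \<open>In the vertex condition \<open>J\<close> may be equal to \<open>I\<close>.\<close>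

definition nil_graph_verts :: "('a, 'b) ring_scheme \<Rightarrow> 'a set set" where
  "nil_graph_verts R =
     {I. nontrivial_ideal I R \<and> (\<exists>J. nontrivial_ideal J R \<and> I \<cdot>\<^bsub>R\<^esub> J \<subseteq> nilradical R)}"

definition nil_graph :: "('a, 'b) ring_scheme \<Rightarrow> 'a set pair_pre_digraph" where
  "nil_graph R =
     \<lparr> pverts = nil_graph_verts R,
       parcs = {(I, J). I \<in> nil_graph_verts R \<and> J \<in> nil_graph_verts R \<and> I \<noteq> J \<and>
                        I \<cdot>\<^bsub>R\<^esub> J \<subseteq> nilradical R} \<rparr>"

lemma (in cring) nil_graph_pair_bidirected_digraph: "pair_bidirected_digraph (nil_graph R)"
proof
  have "(J, I) \<in> parcs (nil_graph R)" if "(I, J) \<in> parcs (nil_graph R)" for I J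
  proof -
    have "ideal I R" "ideal J R"
      using that by (simp_all add: nil_graph_def nil_graph_verts_def nontrivial_ideal_def)
    then have "J \<cdot> I = I \<cdot> J"
      by (rule ideal_prod_commute[symmetric])
    then show ?thesis
      using that by (auto simp: nil_graph_def)
  qed
  then show "symmetric (with_proj (nil_graph R))"
    by (simp add: symmetric_def sym_def)
qed (simp_all add: nil_graph_def split: prod.splits)

end

theory Submission
  imports Defs
begin

text \<open>
  Write \<open>N\<close> for the nilradical. The two cases \<open>N \<noteq> 0\<close> and \<open>N = 0\<close> have different reasons.

  If \<open>N \<noteq> 0\<close>, then \<open>N\<close> is itself a non-trivial ideal, and \<open>N \<cdot> J \<subseteq> N\<close> for every \<open>J\<close>. Hence all
  non-trivial ideals are vertices and \<open>N\<close> is adjacent to every other one; in a bipartition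
  the part of \<open>N\<close> is therefore \<open>{N}\<close>, and the graph is a star centred at \<open>N\<close>
  (\<open>complete_bipartition_nilradical\<close>). In particular every edge has \<open>N\<close> as an end. If \<open>ab \<in> N\<close> with
  \<open>a, b \<notin> N\<close>, the principal ideals of \<open>a\<close> and \<open>b\<close> would be the ends of an edge that avoids \<open>N\<close>, so
  \<open>N\<close> is prime (\<open>nilradical_prime_if_no_other_edges\<close>). As every prime ideal contains \<open>N\<close>, it is the
  only minimal one.

  If \<open>N = 0\<close>, no nonzero ideal has square zero, so every vertex has a neighbour different from
  itself. Take \<open>I\<close> and \<open>J\<close> in opposite parts, with neighbours \<open>I'\<close> and \<open>J'\<close>. If \<open>I \<cdot> J\<close> were nonzero,
  then, being contained in \<open>I \<inter> J\<close>, it would be a vertex adjacent to both \<open>I'\<close> and \<open>J'\<close>. But these lie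
  in opposite parts, so \<open>I \<cdot> J\<close> could lie in neither (\<open>reduced_bipartition_complete\<close>).
\<close>

section \<open>The nilradical\<close>

context cring
begin

text \<open>
  The binomial expansion in an inductive form: each factor \<open>a \<oplus> b\<close> that is multiplied out
  raises the exponent of \<open>a\<close> or of \<open>b\<close> by one, so that no binomial coefficients occur.
\<close>

lemma add_pow_mult_pow_eq_zero:
  assumes "a \<in> carrier R" "b \<in> carrier R"
    and "a [^] (m::nat) = \<zero>" "b [^] (n::nat) = \<zero>"
    and "m + n \<le> i + j + k"
  shows "(a \<oplus> b) [^] (k::nat) \<otimes> (a [^] (i::nat) \<otimes> b [^] (j::nat)) = \<zero>"
  using assms(5)
proof (induction k arbitrary: i j)
  case 0
  have vanish: "c [^] p = \<zero>" if "c \<in> carrier R" "c [^] q = \<zero>" "q \<le> p" for c and p q :: nat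
  proof -
    have "c [^] p = c [^] q \<otimes> c [^] (p - q)"
      using nat_pow_mult[of c q "p - q"] that(1,3) by simp
    then show ?thesis
      using that(1,2) by simp
  qed
  have "m \<le> i \<or> n \<le> j"
    using 0 by linarith
  then have "a [^] i = \<zero> \<or> b [^] j = \<zero>"
    using vanish assms(1-4) by blast
  then show ?case
    using assms(1,2) by auto
next
  case (Suc k)
  have "(a \<oplus> b) [^] Suc k \<otimes> (a [^] i \<otimes> b [^] j)
      = (a \<oplus> b) [^] k \<otimes> (a [^] Suc i \<otimes> b [^] j) \<oplus> (a \<oplus> b) [^] k \<otimes> (a [^] i \<otimes> b [^] Suc j)"
    using assms(1,2) by (simp add: l_distr r_distr m_ac)
  moreover have "(a \<oplus> b) [^] k \<otimes> (a [^] Suc i \<otimes> b [^] j) = \<zero>"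
    by (rule Suc.IH) (use Suc.prems in simp)
  moreover have "(a \<oplus> b) [^] k \<otimes> (a [^] i \<otimes> b [^] Suc j) = \<zero>"
    by (rule Suc.IH) (use Suc.prems in simp)
  ultimately show ?case
    by simp
qed

lemma nilradical_mult_closed:
  assumes "a \<in> nilradical R" "x \<in> carrier R"
  shows "x \<otimes> a \<in> nilradical R"
proof -
  obtain n :: nat where "a \<in> carrier R" "a [^] n = \<zero>"
    using assms(1) by (auto simp: nilradical_def)
  then have "(x \<otimes> a) [^] n = \<zero>"
    using assms(2) by (simp add: nat_pow_distrib)
  then show ?thesis
    using \<open>a \<in> carrier R\<close> assms(2) by (auto simp: nilradical_def)
qed

lemma nilradical_add_closed:
  assumes "a \<in> nilradical R" "b \<in> nilradical R"
  shows "a \<oplus> b \<in> nilradical R"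
proof -
  obtain m n :: nat
    where "a \<in> carrier R" "a [^] m = \<zero>" "b \<in> carrier R" "b [^] n = \<zero>"
    using assms by (auto simp: nilradical_def)
  then have "(a \<oplus> b) [^] (m + n) = \<zero>"
    using add_pow_mult_pow_eq_zero[of a b m n 0 0 "m + n"] by simp
  then show ?thesis
    using \<open>a \<in> carrier R\<close> \<open>b \<in> carrier R\<close> by (auto simp: nilradical_def)
qed

lemma nilradical_ideal: "ideal (nilradical R) R"
proof (rule idealI[OF ring_axioms])
  show "subgroup (nilradical R) (add_monoid R)"
  proof (rule add.subgroupI)
    show "nilradical R \<subseteq> carrier R"
      by (auto simp: nilradical_def)
    have "\<zero> [^] (1::nat) = \<zero>"
      by simp
    then show "nilradical R \<noteq> {}"
      unfolding nilradical_def by blast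
  next
    fix a assume a: "a \<in> nilradical R"
    then have "(\<ominus> \<one>) \<otimes> a = \<ominus> a"
      by (simp add: nilradical_def l_minus)
    then show "\<ominus> a \<in> nilradical R"
      using nilradical_mult_closed[OF a, of "\<ominus> \<one>"] by simp
  qed (simp add: nilradical_add_closed)
next
  fix a x assume ax: "a \<in> nilradical R" "x \<in> carrier R"
  then show "x \<otimes> a \<in> nilradical R"
    by (rule nilradical_mult_closed)
  then show "a \<otimes> x \<in> nilradical R"
    using ax by (simp add: m_comm nilradical_def)
qed

lemma one_in_nilradical_iff: "\<one> \<in> nilradical R \<longleftrightarrow> \<one> = \<zero>"
  by (auto simp: nilradical_def)

lemma nilradical_subset_primeideal:
  assumes "primeideal P R"
  shows "nilradical R \<subseteq> P"
proof
  fix a assume "a \<in> nilradical R"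
  then obtain n :: nat where a: "a \<in> carrier R" "a [^] n = \<zero>"
    by (auto simp: nilradical_def)
  interpret primeideal P R by fact
  have "a [^] k \<in> P \<Longrightarrow> a \<in> P" for k :: nat
  proof (induction k)
    case 0
    then show ?case
      using one_imp_carrier I_notcarr by simp
  next
    case (Suc k)
    then show ?case
      using I_prime[of "a [^] k" a] a(1) by auto
  qed
  then show "a \<in> P"
    using a(2) zero_closed by metis
qed

lemma square_in_nilradicalD:
  assumes "a \<in> carrier R" "a \<otimes> a \<in> nilradical R"
  shows "a \<in> nilradical R"
proof -
  obtain n :: nat where "(a \<otimes> a) [^] n = \<zero>"
    using assms(2) by (auto simp: nilradical_def)
  then have "a [^] (n + n) = \<zero>"
    using assms(1) by (simp add: nat_pow_distrib nat_pow_mult)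
  then show ?thesis
    using assms(1) by (auto simp: nilradical_def)
qed


section \<open>Products of ideals\<close>

lemma ideal_prod_subset_iff:
  assumes "ideal K R"
  shows "I \<cdot> J \<subseteq> K \<longleftrightarrow> (\<forall>a\<in>I. \<forall>b\<in>J. a \<otimes> b \<in> K)"
proof
  assume "I \<cdot> J \<subseteq> K"
  then show "\<forall>a\<in>I. \<forall>b\<in>J. a \<otimes> b \<in> K"
    by (auto intro: ideal_prod.prod)
next
  assume K: "\<forall>a\<in>I. \<forall>b\<in>J. a \<otimes> b \<in> K"
  interpret ideal K R by fact
  show "I \<cdot> J \<subseteq> K"
  proof
    fix s assume "s \<in> I \<cdot> J"
    then show "s \<in> K"
      by induction (use K in auto)
  qed
qed

lemma ideal_square_subset_nilradicalD:
  assumes "ideal I R" "I \<cdot> I \<subseteq> nilradical R"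
  shows "I \<subseteq> nilradical R"
proof
  fix a assume a: "a \<in> I"
  then have "a \<otimes> a \<in> nilradical R"
    using assms(2) by (auto intro: ideal_prod.prod)
  then show "a \<in> nilradical R"
    by (rule square_in_nilradicalD[OF ideal.Icarr[OF assms(1) a]])
qed

lemma cgenideal_prod_subset:
  assumes "ideal K R" "a \<in> carrier R" "b \<in> carrier R" "a \<otimes> b \<in> K"
  shows "(PIdl a) \<cdot> (PIdl b) \<subseteq> K"
  unfolding ideal_prod_subset_iff[OF assms(1)]
proof (intro ballI)
  fix s t assume "s \<in> PIdl a" "t \<in> PIdl b"
  then obtain x y where "x \<in> carrier R" "s = x \<otimes> a" "y \<in> carrier R" "t = y \<otimes> b"
    by (auto simp: cgenideal_def)
  moreover from this have "s \<otimes> t = (x \<otimes> y) \<otimes> (a \<otimes> b)"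
    using assms(2,3) by (simp add: m_ac)
  ultimately show "s \<otimes> t \<in> K"
    using ideal.I_l_closed[OF assms(1,4)] by simp
qed


section \<open>Rings with nonzero nilradical\<close>

lemma pverts_nil_graph: "pverts (nil_graph R) = nil_graph_verts R"
  by (simp add: nil_graph_def)

lemma nontrivial_ideal_nilradical:
  assumes "\<one> \<noteq> \<zero>" "\<not> reduced_ring R"
  shows "nontrivial_ideal (nilradical R) R"
proof -
  have "nilradical R \<noteq> carrier R"
    using assms(1) one_closed one_in_nilradical_iff by blast
  then show ?thesis
    using assms(2) nilradical_ideal by (simp add: nontrivial_ideal_def reduced_ring_def)
qed

lemma nontrivial_ideal_in_nil_graph_verts:
  assumes "nontrivial_ideal (nilradical R) R" "nontrivial_ideal I R"
  shows "I \<in> nil_graph_verts R"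
proof -
  have "I \<cdot> nilradical R \<subseteq> nilradical R"
    using ideal_prod_inter[of I "nilradical R"] assms by (simp add: nontrivial_ideal_def)
  then show ?thesis
    using assms unfolding nil_graph_verts_def by blast
qed

lemma nilradical_adjacent:
  assumes "nontrivial_ideal (nilradical R) R" "I \<in> nil_graph_verts R" "I \<noteq> nilradical R"
  shows "(nilradical R, I) \<in> parcs (nil_graph R)" "(I, nilradical R) \<in> parcs (nil_graph R)"
proof -
  have "ideal I R"
    using assms(2) by (simp add: nil_graph_verts_def nontrivial_ideal_def)
  then show "(nilradical R, I) \<in> parcs (nil_graph R)" "(I, nilradical R) \<in> parcs (nil_graph R)"
    using assms nontrivial_ideal_in_nil_graph_verts[OF assms(1,1)] nilradical_ideal
      ideal_prod_inter[of I "nilradical R"] ideal_prod_inter[of "nilradical R" I]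
    by (auto simp: nil_graph_def)
qed

lemma complete_bipartition_nilradical:
  assumes nontriv: "nontrivial_ideal (nilradical R) R"
    and bip: "bipartition (nil_graph R) U V"
    and inU: "nilradical R \<in> U"
  shows "U = {nilradical R} \<and> complete_bipartition (nil_graph R) U V"
proof -
  have verts: "nil_graph_verts R = U \<union> V" and disj: "U \<inter> V = {}"
    and edges: "parcs (nil_graph R) \<subseteq> U \<times> V \<union> V \<times> U"
    using bip by (simp_all add: bipartition_def pverts_nil_graph)
  have "I = nilradical R" if "I \<in> U" for I
    using nilradical_adjacent(1)[OF nontriv, of I] that verts edges inU disj by blast
  then have U: "U = {nilradical R}"
    using inU by blast
  moreover have "(nilradical R, J) \<in> parcs (nil_graph R) \<and> (J, nilradical R) \<in> parcs (nil_graph R)"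
    if "J \<in> V" for J
    using nilradical_adjacent[OF nontriv, of J] that verts disj inU by blast
  ultimately show ?thesis
    using bip by (simp add: complete_bipartition_def)
qed

text \<open>
  Suppose that \<open>a \<otimes> b\<close> is nilpotent but \<open>a\<close> and \<open>b\<close> are not. Neither is a unit, for then the other
  would be nilpotent. So both generate vertices, whose product consists of nilpotent elements. These
  vertices differ, because otherwise \<open>b \<otimes> b\<close> would be nilpotent; hence they form a forbidden edge.
\<close>

lemma nilradical_prime_if_no_other_edges:
  assumes one: "\<one> \<noteq> \<zero>"
    and nontriv: "nontrivial_ideal (nilradical R) R"
    and no_edge: "\<And>I J. (I, J) \<in> parcs (nil_graph R) \<Longrightarrow> I = nilradical R \<or> J = nilradical R"
  shows "primeideal (nilradical R) R"
proof (rule primeidealI[OF nilradical_ideal is_cring])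
  show "carrier R \<noteq> nilradical R"
    using nontriv by (auto simp: nontrivial_ideal_def)
next
  fix a b assume ab: "a \<in> carrier R" "b \<in> carrier R" "a \<otimes> b \<in> nilradical R"
  interpret N: ideal "nilradical R" R by (rule nilradical_ideal)
  show "a \<in> nilradical R \<or> b \<in> nilradical R"
  proof (rule ccontr)
    assume "\<not> (a \<in> nilradical R \<or> b \<in> nilradical R)"
    then have notin: "a \<notin> nilradical R" "b \<notin> nilradical R"
      by simp_all
    have nontriv_gen: "nontrivial_ideal (PIdl c) R"
      if c: "c \<in> carrier R" "c \<notin> nilradical R"
        and d: "d \<in> carrier R" "d \<notin> nilradical R" "c \<otimes> d \<in> nilradical R" for c d
    proof -
      have "PIdl c \<noteq> {\<zero>}"
        using cgenideal_self[OF c(1)] c(2) N.zero_closed by auto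
      moreover have "PIdl c \<noteq> carrier R"
      proof
        assume "PIdl c = carrier R"
        then obtain x where x: "x \<in> carrier R" "\<one> = x \<otimes> c"
          using one_closed unfolding cgenideal_def by blast
        have "d = x \<otimes> (c \<otimes> d)"
          using x c(1) d(1) by (metis l_one m_assoc)
        then show False
          using N.I_l_closed[OF d(3) x(1)] d(2) by simp
      qed
      ultimately show ?thesis
        using cgenideal_ideal[OF c(1)] by (simp add: nontrivial_ideal_def)
    qed
    have verts: "PIdl a \<in> nil_graph_verts R" "PIdl b \<in> nil_graph_verts R"
      using nontriv_gen[of a b] nontriv_gen[of b a] ab notin m_comm[OF ab(1,2)]
        nontrivial_ideal_in_nil_graph_verts[OF nontriv] by auto
    have prod: "(PIdl a) \<cdot> (PIdl b) \<subseteq> nilradical R"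
      using cgenideal_prod_subset[OF nilradical_ideal ab] .
    have "PIdl a \<noteq> PIdl b"
    proof
      assume "PIdl a = PIdl b"
      then have "PIdl b \<subseteq> nilradical R"
        using prod ideal_square_subset_nilradicalD cgenideal_ideal[OF ab(2)] by simp
      then show False
        using cgenideal_self[OF ab(2)] notin(2) by blast
    qed
    then have "(PIdl a, PIdl b) \<in> parcs (nil_graph R)"
      using verts prod by (simp add: nil_graph_def)
    then have "PIdl a = nilradical R \<or> PIdl b = nilradical R"
      by (rule no_edge)
    then show False
      using cgenideal_self ab(1,2) notin by blast
  qed
qed

lemma nilradical_unique_minimal_prime:
  assumes "primeideal (nilradical R) R"
  shows "minimal_primeideal P R \<longleftrightarrow> P = nilradical R"
  using assms nilradical_subset_primeideal unfolding minimal_primeideal_def by blast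


section \<open>Reduced rings\<close>

lemma reduced_square_zeroD:
  assumes "reduced_ring R" "ideal I R" "I \<cdot> I \<subseteq> nilradical R"
  shows "I = {\<zero>}"
proof -
  have "\<zero> \<in> I"
    using additive_subgroup.zero_closed[OF ideal.axioms(1)[OF assms(2)]] .
  then show ?thesis
    using ideal_square_subset_nilradicalD[OF assms(2,3)] assms(1)
    unfolding reduced_ring_def by blast
qed

lemma reduced_vertex_has_neighbour:
  assumes red: "reduced_ring R" and I: "I \<in> nil_graph_verts R"
  obtains I' where "(I, I') \<in> parcs (nil_graph R)"
proof -
  obtain I' where I': "nontrivial_ideal I' R" "I \<cdot> I' \<subseteq> nilradical R"
    using I unfolding nil_graph_verts_def by blast
  have "nontrivial_ideal I R"
    using I by (simp add: nil_graph_verts_def)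
  moreover from this have "I' \<cdot> I \<subseteq> nilradical R"
    using I' ideal_prod_commute[of I I'] unfolding nontrivial_ideal_def by metis
  ultimately have "I' \<in> nil_graph_verts R"
    using I'(1) unfolding nil_graph_verts_def by blast
  moreover have "I \<noteq> I'"
    using reduced_square_zeroD[OF red, of I] \<open>nontrivial_ideal I R\<close> I'(2)
    by (auto simp: nontrivial_ideal_def)
  ultimately show thesis
    using I I'(2) that[of I'] by (simp add: nil_graph_def)
qed

text \<open>
  Shrinking a vertex to a smaller nonzero ideal keeps its neighbours. The neighbour is never the
  smaller ideal itself, since that ideal would then have square zero.
\<close>

lemma reduced_subideal_adjacent:
  assumes red: "reduced_ring R" and edge: "(I, J) \<in> parcs (nil_graph R)"
    and L: "ideal L R" "L \<noteq> {\<zero>}" "L \<subseteq> I"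
  shows "(L, J) \<in> parcs (nil_graph R)"
proof -
  have I: "nontrivial_ideal I R" and J: "nontrivial_ideal J R" "J \<in> nil_graph_verts R"
    and IJ: "I \<cdot> J \<subseteq> nilradical R"
    using edge by (simp_all add: nil_graph_def nil_graph_verts_def)
  have LJ: "L \<cdot> J \<subseteq> nilradical R"
    using IJ L(3) unfolding ideal_prod_subset_iff[OF nilradical_ideal] by blast
  have "I \<subseteq> carrier R" "I \<noteq> carrier R"
    using I ideal.Icarr[of I R] by (auto simp: nontrivial_ideal_def)
  then have "L \<noteq> carrier R"
    using L(3) by blast
  then have "nontrivial_ideal L R"
    using L by (simp add: nontrivial_ideal_def)
  then have "L \<in> nil_graph_verts R"
    using J(1) LJ unfolding nil_graph_verts_def by blast
  moreover have "L \<noteq> J"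
    using reduced_square_zeroD[OF red L(1)] LJ L(2) by metis
  ultimately show ?thesis
    using J(2) LJ by (simp add: nil_graph_def)
qed

lemma reduced_bipartition_complete:
  assumes red: "reduced_ring R" and bip: "bipartition (nil_graph R) U V"
  shows "complete_bipartition (nil_graph R) U V"
proof -
  have verts: "nil_graph_verts R = U \<union> V" and disj: "U \<inter> V = {}"
    and edges: "parcs (nil_graph R) \<subseteq> U \<times> V \<union> V \<times> U"
    using bip by (simp_all add: bipartition_def pverts_nil_graph)
  have "(I, J) \<in> parcs (nil_graph R) \<and> (J, I) \<in> parcs (nil_graph R)"
    if I: "I \<in> U" and J: "J \<in> V" for I J
  proof -
    have ideals: "ideal I R" "ideal J R"
      using I J verts by (auto simp: nil_graph_verts_def nontrivial_ideal_def)
    obtain I' where I': "(I, I') \<in> parcs (nil_graph R)"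
      using reduced_vertex_has_neighbour[OF red] I verts by blast
    obtain J' where J': "(J, J') \<in> parcs (nil_graph R)"
      using reduced_vertex_has_neighbour[OF red] J verts by blast
    have "I \<cdot> J = {\<zero>}"
    proof (rule ccontr)
      assume nz: "I \<cdot> J \<noteq> {\<zero>}"
      have "(I \<cdot> J, I') \<in> parcs (nil_graph R)" "(I \<cdot> J, J') \<in> parcs (nil_graph R)"
        using ideal_prod_is_ideal[OF ideals] ideal_prod_inter[OF ideals] nz
          reduced_subideal_adjacent[OF red I'] reduced_subideal_adjacent[OF red J'] by auto
      then have "I \<cdot> J \<in> U" "I \<cdot> J \<in> V"
        using edges disj I' J' I J by blast+
      then show False
        using disj by blast
    qed
    then have "I \<cdot> J \<subseteq> nilradical R"
      using red by (simp add: reduced_ring_def)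
    moreover from this have "J \<cdot> I \<subseteq> nilradical R"
      unfolding ideal_prod_commute[OF ideals] .
    moreover have "I \<noteq> J"
      using I J disj by blast
    ultimately show ?thesis
      using I J verts by (simp add: nil_graph_def)
  qed
  then show ?thesis
    using bip by (simp add: complete_bipartition_def)
qed

end


section \<open>Bipartite nil-graphs\<close>

theorem theorem6:
  fixes R :: "('a, 'b) ring_scheme"
  assumes "cring R"
    and "\<one>\<^bsub>R\<^esub> \<noteq> \<zero>\<^bsub>R\<^esub>"
    and "\<not> domain R"
    and "bipartite (nil_graph R)"
  shows "complete_bipartite (nil_graph R) \<and>
    (\<not> reduced_ring R \<longrightarrow>
      star_graph (nil_graph R) \<and>
      minimal_primeideal (nilradical R) R \<and>
      (\<forall>P. minimal_primeideal P R \<longrightarrow> P = nilradical R))"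
proof -
  interpret cring R by fact
  obtain U0 V0 where bip0: "bipartition (nil_graph R) U0 V0"
    using assms(4) by (auto simp: bipartite_def)
  show ?thesis
  proof (cases "reduced_ring R")
    case True
    then show ?thesis
      using reduced_bipartition_complete[OF True bip0] by (auto simp: complete_bipartite_def)
  next
    case False
    have nontriv: "nontrivial_ideal (nilradical R) R"
      using nontrivial_ideal_nilradical[OF assms(2) False] .
    have "nilradical R \<in> U0 \<union> V0"
      using nontrivial_ideal_in_nil_graph_verts[OF nontriv nontriv] bip0
      by (simp add: bipartition_def pverts_nil_graph)
    moreover have "bipartition (nil_graph R) V0 U0"
      using bip0 by (auto simp: bipartition_def)
    ultimately obtain U V where bip: "bipartition (nil_graph R) U V" and "nilradical R \<in> U"
      using bip0 by blast
    then have U: "U = {nilradical R}" and complete: "complete_bipartition (nil_graph R) U V"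
      using complete_bipartition_nilradical[OF nontriv] by blast+
    have "I = nilradical R \<or> J = nilradical R" if "(I, J) \<in> parcs (nil_graph R)" for I J
      using that bip U by (auto simp: bipartition_def)
    then have "primeideal (nilradical R) R"
      using nilradical_prime_if_no_other_edges[OF assms(2) nontriv] by blast
    then have "minimal_primeideal P R \<longleftrightarrow> P = nilradical R" for P
      by (rule nilradical_unique_minimal_prime)
    moreover have "star_graph (nil_graph R)"
      using complete U unfolding star_graph_def by (intro exI[of _ U] exI[of _ V]) simp
    ultimately show ?thesis
      using complete by (auto simp: complete_bipartite_def)
  qed
qed

end
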